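(* Let $n\ge 1$ and let $q_n\in\mathbb{R}[t_1,\dots,t_n]$ be the Stanley–Pitman volume polynomial. Write $D_i=\partial/\partial t_i$ for $1\le i\le n$ and $D_0:=0$. Then $q_n$ is annihilated by each of the differential operators $$D_i(D_i-D_{i-1}),\qquad i=1,\dots,n,$$ and every homogeneous polynomial of degree $n$ in $t_1,\dots,t_n$ that is annihilated by all of these operators is a scalar multiple of $q_n$. Moreover, for $j\ge 0$ let $\mathcal{P}_{n,j}$ be the space of homogeneous polynomials of degree $j$ in $t_1,\dots,t_n$ annihilated by each of the operators $D_i(D_i-D_{i-1})$, $i=1,\dots,n$. Then: (1) $\mathcal{P}_{n,j}$ is contained in the linear span of the translates $t\mapsto q_n(t+a)$, $a\in\mathbb{R}^n$; (2) $\dim \mathcal{P}_{n,j}=\binom{n}{j}$.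
   Context: For $t\in\mathbb{R}_+^n$ (with $\mathbb{R}_+=[0,\infty)$), the Stanley–Pitman polytope is $Q_n(t)=\{r\in\mathbb{R}_+^n:\ \sum_{i=j}^n r_i\le \sum_{i=j}^n t_i \text{ for } 1\le j\le n\}$, and $q_n(t):=\operatorname{vol}(Q_n(t))$; it is known that $q_n$ is a polynomial function of $t$, regarded as an element of $\mathbb{R}[t_1,\dots,t_n]$ (e.g. $q_2(t)=t_2^2/2+t_1t_2$). *)

theory Defs
  imports "HOL-Analysis.Analysis" "HOL-Library.Poly_Mapping"
begin

instantiation poly_mapping :: (type, real_vector) real_vector
begin

definition scaleR_poly_mapping :: "real \<Rightarrow> ('a \<Rightarrow>\<^sub>0 'b) \<Rightarrow> ('a \<Rightarrow>\<^sub>0 'b)" where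
  "scaleR_poly_mapping c p = Poly_Mapping.map (scaleR c) p"

lemma lookup_scaleR [simp]:
  "Poly_Mapping.lookup (c *\<^sub>R p) k = c *\<^sub>R Poly_Mapping.lookup (p :: 'a \<Rightarrow>\<^sub>0 'b) k"
  by (simp add: scaleR_poly_mapping_def Poly_Mapping.map.rep_eq when_def)

instance
  by standard (simp_all add: poly_mapping_eq_iff fun_eq_iff lookup_add algebra_simps)

end

text \<open>
  Real polynomials in the variables $t_0, t_1, t_2, \ldots$: a finitely supported map from
  exponent vectors to coefficients; the ring operations are those of \<^theory>\<open>HOL-Library.Poly_Mapping\<close>.
\<close>

type_synonym mpoly = "(nat \<Rightarrow>\<^sub>0 nat) \<Rightarrow>\<^sub>0 real"

definition Const :: "real \<Rightarrow> mpoly" where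
  "Const c = Poly_Mapping.single 0 c"

definition Var :: "nat \<Rightarrow> mpoly" where
  "Var i = Poly_Mapping.single (Poly_Mapping.single i 1) 1"

definition eval :: "(nat \<Rightarrow> real) \<Rightarrow> mpoly \<Rightarrow> real" where
  "eval t p = (\<Sum>m\<in>Poly_Mapping.keys p. Poly_Mapping.lookup p m *
     (\<Prod>i\<in>Poly_Mapping.keys m. t i ^ Poly_Mapping.lookup m i))"

text \<open>The polynomial $p(t + a)$.\<close>

definition translate :: "(nat \<Rightarrow> real) \<Rightarrow> mpoly \<Rightarrow> mpoly" where
  "translate a p = (\<Sum>m\<in>Poly_Mapping.keys p. Const (Poly_Mapping.lookup p m) *
     (\<Prod>i\<in>Poly_Mapping.keys m. (Var i + Const (a i)) ^ Poly_Mapping.lookup m i))"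

text \<open>
  The subtraction of exponent vectors is truncated, but only where \<open>Poly_Mapping.lookup m i = 0\<close>
  and the coefficient vanishes.
\<close>

definition partial_deriv :: "nat \<Rightarrow> mpoly \<Rightarrow> mpoly" where
  "partial_deriv i p = (\<Sum>m\<in>Poly_Mapping.keys p.
     Poly_Mapping.single (m - Poly_Mapping.single i 1)
       (real (Poly_Mapping.lookup m i) * Poly_Mapping.lookup p m))"

definition D :: "nat \<Rightarrow> mpoly \<Rightarrow> mpoly" where
  "D i = (if i = 0 then (\<lambda>p. 0) else partial_deriv i)"

definition polys :: "nat \<Rightarrow> mpoly set" where
  "polys n = {p. \<forall>m\<in>Poly_Mapping.keys p. Poly_Mapping.keys m \<subseteq> {1..n}}"

text \<open>As usual, the zero polynomial counts as homogeneous of every degree.\<close>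

definition homogeneous :: "nat \<Rightarrow> mpoly \<Rightarrow> bool" where
  "homogeneous j p \<longleftrightarrow>
     (\<forall>m\<in>Poly_Mapping.keys p. (\<Sum>i\<in>Poly_Mapping.keys m. Poly_Mapping.lookup m i) = j)"

definition annihilated :: "nat \<Rightarrow> mpoly \<Rightarrow> bool" where
  "annihilated n p \<longleftrightarrow> (\<forall>i\<in>{1..n}. D i (D i p - D (i - 1) p) = 0)"

definition P :: "nat \<Rightarrow> nat \<Rightarrow> mpoly set" where
  "P n j = {p \<in> polys n. homogeneous j p \<and> annihilated n p}"

text \<open>
  Points of $\mathbb{R}^n$ are the functions in \<open>{1..n} \<rightarrow>\<^sub>E UNIV\<close>, the space of the measure
  \<open>\<Pi>\<^sub>M i\<in>{1..n}. lborel\<close>.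
\<close>

definition Q :: "nat \<Rightarrow> (nat \<Rightarrow> real) \<Rightarrow> (nat \<Rightarrow> real) set" where
  "Q n t = {r \<in> {1..n} \<rightarrow>\<^sub>E {0..}. \<forall>j\<in>{1..n}. (\<Sum>i=j..n. r i) \<le> (\<Sum>i=j..n. t i)}"

text \<open>
  The volume is given by a polynomial on the nonnegative orthant only, so \<open>q n\<close> is the
  (unique) polynomial agreeing with it there.
\<close>

definition q :: "nat \<Rightarrow> mpoly" where
  "q n = (THE p. p \<in> polys n \<and>
     (\<forall>t \<in> {1..n} \<rightarrow>\<^sub>E {0..}. eval t p = measure (\<Pi>\<^sub>M i\<in>{1..n}. lborel) (Q n t)))"

end

theory Submission
  imports Defs
begin

text \<open>
  Multiply the coefficient of \<open>t\<^sup>k\<close> by \<open>k!\<close>; then \<open>D\<^sub>i\<close> shifts these scaled coefficients by the \<open>i\<close>th unit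
  exponent. An element of \<open>P n j\<close> is determined by its squarefree coefficients, because the operators
  trade \<open>t\<^sub>i\<^sup>2\<close> for \<open>t\<^sub>i t\<^sub>i\<^sub>-\<^sub>1\<close>. The volume polynomial is the sum of \<open>t\<^sup>k / k!\<close> over the \<open>k\<close> of degree \<open>n\<close> with
  \<open>\<Sum>i\<ge>j. k\<^sub>i \<ge> n + 1 - j\<close> for all \<open>j\<close>: it satisfies \<open>(D\<^sub>n - D\<^sub>n\<^sub>-\<^sub>1) q\<^sub>n = q\<^sub>n\<^sub>-\<^sub>1\<close>, which integrates to the slicing
  of the polytope along \<open>r\<^sub>n\<close>. For \<open>T \<subseteq> {1..n}\<close> of size \<open>j\<close>, differentiate \<open>q\<^sub>n\<close> once in each variable
  outside \<open>T\<close>: the squarefree coefficient of the result at \<open>S\<close> is 1 or 0 according to whether \<open>S\<close>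
  dominates \<open>T\<close>. This matrix is unitriangular, so these derivatives form a basis of \<open>P n j\<close>, and
  they lie in the span of the translates of \<open>q\<^sub>n\<close>.
\<close>

abbreviation lk :: "('a \<Rightarrow>\<^sub>0 'b::zero) \<Rightarrow> 'a \<Rightarrow> 'b" where "lk \<equiv> Poly_Mapping.lookup"
abbreviation unit_exp :: "nat \<Rightarrow> (nat \<Rightarrow>\<^sub>0 nat)" where "unit_exp i \<equiv> Poly_Mapping.single i (Suc 0)"

subsection \<open>Induction principles\<close>

lemma mpoly_add_induct [case_names single add]:
  fixes p :: mpoly
  assumes single: "\<And>m a. R (Poly_Mapping.single m a)"
    and add: "\<And>p q. R p \<Longrightarrow> R q \<Longrightarrow> R (p + q)"
  shows "R p"
proof -
  have "R (\<Sum>m\<in>M. Poly_Mapping.single m (lk p m))" if "finite M" for M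
    using that
  proof (induction M rule: finite_induct)
    case empty
    show ?case using single[of 0 0] by simp
  qed (simp add: assms)
  moreover have "p = (\<Sum>m\<in>Poly_Mapping.keys p. Poly_Mapping.single m (lk p m))"
    by (rule poly_mapping_eqI) (auto simp: lookup_sum lookup_single when_def in_keys_iff)
  ultimately show ?thesis by (metis finite_keys)
qed

lemma exponent_induct [case_names zero add]:
  fixes k :: "nat \<Rightarrow>\<^sub>0 nat"
  assumes zero: "R 0" and add: "\<And>k i. R k \<Longrightarrow> R (k + unit_exp i)"
  shows "R k"
proof (induction "\<Sum>i\<in>Poly_Mapping.keys k. lk k i" arbitrary: k rule: less_induct)
  case less
  show ?case
  proof (cases "k = 0")
    case False
    then obtain i where i: "i \<in> Poly_Mapping.keys k" by fastforce
    define k' where "k' = k - unit_exp i"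
    have k: "k = k' + unit_exp i"
      using i by (intro poly_mapping_eqI)
        (auto simp: k'_def lookup_add lookup_minus lookup_single when_def in_keys_iff)
    have "(\<Sum>j\<in>Poly_Mapping.keys k'. lk k' j) = (\<Sum>j\<in>Poly_Mapping.keys k. lk k' j)"
      by (intro sum.mono_neutral_left) (auto simp: k in_keys_iff lookup_add)
    also have "\<dots> < (\<Sum>j\<in>Poly_Mapping.keys k. lk k j)"
      using i by (intro sum_strict_mono_ex1) (auto simp: k lookup_add lookup_single when_def intro!: bexI[of _ i])
    finally show ?thesis using add less k by metis
  qed (simp add: zero)
qed

text \<open>Each monomial is a constant times variables, peeled off one at a time. Claims about ring
  homomorphisms and derivations thus need checking on generators only.\<close>

lemma mpoly_induct [case_names Const Var add mult]:
  fixes p :: mpoly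
  assumes Const: "\<And>a. R (Const a)" and Var: "\<And>i. R (Var i)"
    and add: "\<And>p q. R p \<Longrightarrow> R q \<Longrightarrow> R (p + q)" and mult: "\<And>p q. R p \<Longrightarrow> R q \<Longrightarrow> R (p * q)"
  shows "R p"
proof (induction p rule: mpoly_add_induct)
  case (single m a)
  show ?case
  proof (induction m rule: exponent_induct)
    case zero
    show ?case using Const by (simp add: Const_def)
  next
    case (add k i)
    have "Poly_Mapping.single (k + unit_exp i) a = Poly_Mapping.single k a * Var i"
      by (simp add: Var_def mult_single)
    then show ?case using add mult Var by simp
  qed
qed (rule add)

subsection \<open>Substitution homomorphisms\<close>

definition monom_subst :: "(nat \<Rightarrow> 'b::comm_ring_1) \<Rightarrow> (nat \<Rightarrow>\<^sub>0 nat) \<Rightarrow> 'b" where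
  "monom_subst \<phi> m = (\<Prod>i\<in>Poly_Mapping.keys m. \<phi> i ^ lk m i)"

text \<open>The target ring is left open so that evaluation (target: the reals) and translation
  (target: polynomials) share one proof of the homomorphism laws.\<close>

definition subst :: "(real \<Rightarrow> 'b::comm_ring_1) \<Rightarrow> (nat \<Rightarrow> 'b) \<Rightarrow> mpoly \<Rightarrow> 'b" where
  "subst c \<phi> p = (\<Sum>m\<in>Poly_Mapping.keys p. c (lk p m) * monom_subst \<phi> m)"

lemma eval_eq_subst: "eval t = subst (\<lambda>x. x) t"
  by (simp add: fun_eq_iff eval_def subst_def monom_subst_def)

lemma translate_eq_subst: "translate a = subst Const (\<lambda>i. Var i + Const (a i))"
  by (simp add: fun_eq_iff translate_def subst_def monom_subst_def)

lemma monom_subst_superset: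
  assumes "finite M" "Poly_Mapping.keys m \<subseteq> M"
  shows "monom_subst \<phi> m = (\<Prod>i\<in>M. \<phi> i ^ lk m i)"
  unfolding monom_subst_def using assms by (intro prod.mono_neutral_left) (auto simp: in_keys_iff)

lemma monom_subst_zero [simp]: "monom_subst \<phi> 0 = 1"
  by (simp add: monom_subst_def)

lemma monom_subst_single [simp]: "monom_subst \<phi> (Poly_Mapping.single i k) = \<phi> i ^ k"
  by (cases "k = 0") (simp_all add: monom_subst_def)

lemma monom_subst_add: "monom_subst \<phi> (m + m') = monom_subst \<phi> m * monom_subst \<phi> m'"
proof -
  let ?M = "Poly_Mapping.keys m \<union> Poly_Mapping.keys m'"
  have "monom_subst \<phi> x = (\<Prod>i\<in>?M. \<phi> i ^ lk x i)" if "x \<in> {m, m', m + m'}" for x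
    using that keys_add[of m m'] by (intro monom_subst_superset) auto
  then show ?thesis by (simp add: lookup_add power_add prod.distrib)
qed

locale coeff_hom =
  fixes c :: "real \<Rightarrow> 'b::comm_ring_1"
  assumes c_one: "c 1 = 1" and c_add: "c (x + y) = c x + c y"
    and c_mult: "c (x * y) = c x * c y"
begin

lemma c_zero: "c 0 = 0"
  using c_add[of 0 0] by simp

lemma subst_superset:
  assumes "finite M" "Poly_Mapping.keys p \<subseteq> M"
  shows "subst c \<phi> p = (\<Sum>m\<in>M. c (lk p m) * monom_subst \<phi> m)"
  unfolding subst_def using assms by (intro sum.mono_neutral_left) (auto simp: in_keys_iff c_zero)

lemma subst_single: "subst c \<phi> (Poly_Mapping.single m a) = c a * monom_subst \<phi> m"
  by (simp add: subst_def c_zero)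

lemma subst_Const [simp]: "subst c \<phi> (Const a) = c a"
  by (simp add: Const_def subst_single)

lemma subst_Var [simp]: "subst c \<phi> (Var i) = \<phi> i"
  by (simp add: Var_def subst_single c_one)

lemma subst_add: "subst c \<phi> (p + p') = subst c \<phi> p + subst c \<phi> p'"
proof -
  let ?M = "Poly_Mapping.keys p \<union> Poly_Mapping.keys p'"
  have "subst c \<phi> x = (\<Sum>m\<in>?M. c (lk x m) * monom_subst \<phi> m)" if "x \<in> {p, p', p + p'}" for x
    using that keys_add[of p p'] by (intro subst_superset) auto
  then show ?thesis by (simp add: lookup_add c_add distrib_right sum.distrib)
qed

lemma subst_mult: "subst c \<phi> (p * p') = subst c \<phi> p * subst c \<phi> p'"
proof (induction p rule: mpoly_add_induct)
  case (single m a)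
  show ?case
  proof (induction p' rule: mpoly_add_induct)
    case (single m' a')
    show ?case by (simp add: mult_single subst_single c_mult monom_subst_add ac_simps)
  qed (simp add: subst_add distrib_left)
qed (simp add: subst_add distrib_right)

end

interpretation real_hom: coeff_hom "\<lambda>x::real. x"
  by unfold_locales auto

interpretation Const_hom: coeff_hom Const
  by unfold_locales (auto simp: Const_def single_add mult_single)

lemma Const_mult_eq_scaleR: "Const a * p = a *\<^sub>R p"
proof (induction p rule: mpoly_add_induct)
  case (single m b)
  show ?case by (rule poly_mapping_eqI) (simp add: Const_def mult_single lookup_single when_def)
qed (simp add: distrib_left scaleR_add_right)

subsection \<open>Partial derivatives\<close>

lemma lookup_partial_deriv:
  "lk (partial_deriv i p) k = real (lk k i + 1) * lk p (k + unit_exp i)"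
proof -
  have "lk (partial_deriv i p) k =
      (\<Sum>m\<in>Poly_Mapping.keys p. real (lk m i) * lk p m when m - unit_exp i = k)"
    by (simp add: partial_deriv_def lookup_sum lookup_single)
  also have "\<dots> = (\<Sum>m\<in>Poly_Mapping.keys p.
      if k + unit_exp i = m then real (lk k i + 1) * lk p m else 0)"
  proof (intro sum.cong refl)
    fix m
    \<comment> \<open>The truncated subtraction is invertible where \<open>t\<^sub>i\<close> occurs
      in \<open>m\<close>; the remaining terms carry the factor \<open>lk m i = 0\<close>.\<close>
    have "m - unit_exp i = k \<longleftrightarrow> k + unit_exp i = m" if "lk m i \<noteq> 0"
      using that by (auto intro!: poly_mapping_eqI simp: lookup_add lookup_minus lookup_single when_def)
    then show "(real (lk m i) * lk p m when m - unit_exp i = k) =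
        (if k + unit_exp i = m then real (lk k i + 1) * lk p m else 0)"
      by (cases "lk m i = 0") (auto simp: when_def lookup_add)
  qed
  also have "\<dots> = real (lk k i + 1) * lk p (k + unit_exp i)"
    by (auto simp: in_keys_iff)
  finally show ?thesis .
qed

lemma partial_deriv_add: "partial_deriv i (p + p') = partial_deriv i p + partial_deriv i p'"
  by (rule poly_mapping_eqI) (simp add: lookup_partial_deriv lookup_add algebra_simps)

lemma partial_deriv_scaleR: "partial_deriv i (a *\<^sub>R p) = a *\<^sub>R partial_deriv i p"
  by (rule poly_mapping_eqI) (simp add: lookup_partial_deriv)

lemma partial_deriv_single: "partial_deriv i (Poly_Mapping.single m a) =
    Poly_Mapping.single (m - unit_exp i) (real (lk m i) * a)"
  by (simp add: partial_deriv_def)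

lemma partial_deriv_Const [simp]: "partial_deriv i (Const a) = 0"
  by (simp add: Const_def partial_deriv_single)

lemma partial_deriv_Var: "partial_deriv i (Var j) = (if i = j then 1 else 0)"
  by (auto simp: Var_def partial_deriv_single lookup_single)

lemma partial_deriv_mult:
  "partial_deriv i (p * p') = partial_deriv i p * p' + p * partial_deriv i p'"
proof (induction p rule: mpoly_add_induct)
  case (single m a)
  show ?case
  proof (induction p' rule: mpoly_add_induct)
    case (single m' a')
    have *: "x - unit_exp i + y = x + y - unit_exp i" if "lk x i \<noteq> 0" for x y :: "nat \<Rightarrow>\<^sub>0 nat"
      using that by (intro poly_mapping_eqI) (auto simp: lookup_add lookup_minus lookup_single when_def)
    have "partial_deriv i (Poly_Mapping.single m a) * Poly_Mapping.single m' a' =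
        Poly_Mapping.single (m + m' - unit_exp i) (real (lk m i) * a * a')"
      using *[of m m']
      by (cases "lk m i = 0") (simp_all add: partial_deriv_single mult_single)
    moreover have "Poly_Mapping.single m a * partial_deriv i (Poly_Mapping.single m' a') =
        Poly_Mapping.single (m + m' - unit_exp i) (real (lk m' i) * a * a')"
      using *[of m' m]
      by (cases "lk m' i = 0") (simp_all add: partial_deriv_single mult_single ac_simps)
    ultimately show ?case
      by (simp add: mult_single partial_deriv_single lookup_add algebra_simps flip: single_add)
  qed (simp add: partial_deriv_add distrib_left)
qed (simp add: partial_deriv_add distrib_right)

section \<open>Derivatives and shifts of one variable\<close>

lemma partial_deriv_translate:
  "partial_deriv i (translate a p) = translate a (partial_deriv i p)"
  unfolding translate_eq_subst
proof (induction p rule: mpoly_induct)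
  case (Const b)
  show ?case using Const_hom.subst_Const[of _ 0] by (simp add: Const_def[of 0])
next
  case (Var j)
  show ?case using Const_hom.subst_Const[of _ 0] Const_hom.subst_Const[of _ 1]
    by (simp add: partial_deriv_Var partial_deriv_add Const_def[of 0] Const_def[of 1])
qed (simp_all add: partial_deriv_add partial_deriv_mult Const_hom.subst_add Const_hom.subst_mult)

text \<open>\<open>V\<close> is the Taylor expansion in direction \<open>i\<close>, a univariate
  polynomial over the target ring. Its linear coefficient exhibits the derivative algebraically,
  without limits.\<close>

lemma (in coeff_hom) subst_taylor:
  "\<exists>V. (\<forall>s. subst c (\<phi>(i := \<phi> i + c s)) p = poly V (c s)) \<and>
     coeff V 1 = subst c \<phi> (partial_deriv i p)"
proof -
  have zero: "subst c \<phi> 0 = 0" and one: "subst c \<phi> 1 = 1"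
    using subst_Const[of \<phi> 0] subst_Const[of \<phi> 1] by (simp_all add: Const_def c_zero c_one)
  define \<psi> where "\<psi> = (\<lambda>s. \<phi>(i := \<phi> i + c s))"
  \<comment> \<open>The constant coefficient joins the induction because the linear coefficient of a
    product involves the constant coefficients of both factors.\<close>
  have "\<exists>V. (\<forall>s. subst c (\<psi> s) p = poly V (c s)) \<and>
     coeff V 0 = subst c \<phi> p \<and> coeff V 1 = subst c \<phi> (partial_deriv i p)"
  proof (induction p rule: mpoly_induct)
    case (Const a)
    show ?case by (rule exI[of _ "[:c a:]"]) (simp add: zero)
  next
    case (Var j)
    show ?case
      by (rule exI[of _ "if j = i then [:\<phi> i, 1:] else [:\<phi> j:]"])
        (auto simp: \<psi>_def zero one partial_deriv_Var)
  next
    case (add p p')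
    then obtain V V' where
      "\<forall>s. subst c (\<psi> s) p = poly V (c s)" "coeff V 0 = subst c \<phi> p"
      "coeff V 1 = subst c \<phi> (partial_deriv i p)"
      "\<forall>s. subst c (\<psi> s) p' = poly V' (c s)" "coeff V' 0 = subst c \<phi> p'"
      "coeff V' 1 = subst c \<phi> (partial_deriv i p')" by blast
    then show ?case by (intro exI[of _ "V + V'"]) (simp add: subst_add partial_deriv_add)
  next
    case (mult p p')
    then obtain V V' where
      "\<forall>s. subst c (\<psi> s) p = poly V (c s)" "coeff V 0 = subst c \<phi> p"
      "coeff V 1 = subst c \<phi> (partial_deriv i p)"
      "\<forall>s. subst c (\<psi> s) p' = poly V' (c s)" "coeff V' 0 = subst c \<phi> p'"
      "coeff V' 1 = subst c \<phi> (partial_deriv i p')" by blast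
    then show ?case
      by (intro exI[of _ "V * V'"])
        (simp add: subst_mult subst_add partial_deriv_mult coeff_mult algebra_simps)
  qed
  then show ?thesis unfolding \<psi>_def by blast
qed

text \<open>A substitute for Vandermonde inversion: \<open>f (2 s) - 2 ^ N f s\<close> kills the top coefficient.\<close>

lemma coeffs_in_subspace:
  fixes v :: "nat \<Rightarrow> 'v::real_vector"
  assumes W: "subspace W" and "\<And>s::real. s \<ge> 0 \<Longrightarrow> (\<Sum>m<N. s ^ m *\<^sub>R v m) \<in> W" and "m < N"
  shows "v m \<in> W"
  using assms(2,3)
proof (induction N arbitrary: v m)
  case (Suc N)
  let ?f = "\<lambda>s::real. \<Sum>m<Suc N. s ^ m *\<^sub>R v m"
  have low: "v l \<in> W" if "l < N" for l
  proof -
    have "(\<Sum>m<N. s ^ m *\<^sub>R ((2 ^ m - 2 ^ N) *\<^sub>R v m)) \<in> W" if "s \<ge> 0" for s :: real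
    proof -
      have "?f (2 * s) - 2 ^ N *\<^sub>R ?f s \<in> W"
        using that Suc.prems(1)[of s] Suc.prems(1)[of "2 * s"] W by (simp add: subspace_diff subspace_scale)
      also have "?f (2 * s) - 2 ^ N *\<^sub>R ?f s = (\<Sum>m<N. s ^ m *\<^sub>R ((2 ^ m - 2 ^ N) *\<^sub>R v m))"
        by (simp add: scaleR_sum_right power_mult_distrib algebra_simps flip: sum_subtractf)
      finally show ?thesis .
    qed
    then have "(2 ^ l - 2 ^ N :: real) *\<^sub>R v l \<in> W" using Suc.IH[of "\<lambda>m. (2 ^ m - 2 ^ N) *\<^sub>R v m"] that by blast
    then have "inverse (2 ^ l - 2 ^ N :: real) *\<^sub>R (2 ^ l - 2 ^ N :: real) *\<^sub>R v l \<in> W"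
      using W subspace_scale by blast
    then show ?thesis using that by simp
  qed
  \<comment> \<open>At \<open>s = 1\<close> the given sum is the plain sum of all vectors; removing
    the lower ones leaves \<open>v N\<close>.\<close>
  have "(\<Sum>m<N. v m) \<in> W"
    using low W by (intro subspace_sum) auto
  then have "?f 1 - (\<Sum>m<N. v m) \<in> W"
    using Suc.prems(1)[of 1] W by (intro subspace_diff) auto
  then have "v N \<in> W" by simp
  then show ?case using low Suc.prems(2) by (auto simp: less_Suc_eq)
qed simp

subsection \<open>Evaluation and translation\<close>

text \<open>A univariate polynomial vanishing for all \<open>s \<ge> 0\<close> has zero
  coefficients. Shifts by nonnegative \<open>s\<close> stay inside the nonnegative orthant.\<close>

lemma eval_taylor_coeff:
  assumes "\<And>s. s \<ge> 0 \<Longrightarrow> eval (t(i := t i + s)) p = 0"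
  shows "eval t (partial_deriv i p) = 0"
proof -
  obtain V where V: "\<And>s. eval (t(i := t i + s)) p = poly V s" "coeff V 1 = eval t (partial_deriv i p)"
    using real_hom.subst_taylor[of t i p] unfolding eval_eq_subst by blast
  have "coeff V 1 \<in> {0}"
  \<comment> \<open>The maximum with 2 keeps index 1 in range even if \<open>V\<close> is
    constant.\<close>
  proof (rule coeffs_in_subspace[where N = "max 2 (Suc (Polynomial.degree V))"])
    fix s :: real
    assume "s \<ge> 0"
    have "(\<Sum>m<max 2 (Suc (Polynomial.degree V)). s ^ m *\<^sub>R coeff V m) = poly V s"
      unfolding poly_altdef
      by (intro sum.mono_neutral_cong_right) (auto simp: coeff_eq_0 not_le)
    then show "(\<Sum>m<max 2 (Suc (Polynomial.degree V)). s ^ m *\<^sub>R coeff V m) \<in> {0}"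
      using V(1)[of s] assms[OF \<open>s \<ge> 0\<close>] by simp
  qed auto
  then show ?thesis using V(2) by simp
qed

text \<open>The translates along direction \<open>i\<close> are the values of a polynomial in
  \<open>s\<close> with coefficients in the polynomial ring. If all values lie in \<open>W\<close>,
  so does the linear coefficient, which is the derivative.\<close>

lemma translate_derivative_in_span:
  assumes "\<And>s. translate (a(i := a i + s)) p \<in> W" "subspace W"
  shows "translate a (partial_deriv i p) \<in> W"
proof -
  have "translate (a(i := a i + s)) p =
      subst Const ((\<lambda>j. Var j + Const (a j))(i := (Var i + Const (a i)) + Const s)) p" for s
    unfolding translate_eq_subst
    by (rule arg_cong[where f = "\<lambda>\<phi>. subst Const \<phi> p"])
      (auto simp: Const_hom.c_add ac_simps)
  then obtain V where V: "\<And>s. translate (a(i := a i + s)) p = poly V (Const s)"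
      "coeff V 1 = translate a (partial_deriv i p)"
    using Const_hom.subst_taylor[of "\<lambda>j. Var j + Const (a j)" i p] unfolding translate_eq_subst by auto
  have pow: "Const s ^ m = Const (s ^ m)" for s m
    by (induction m) (auto simp: Const_hom.c_mult Const_hom.c_one)
  have "coeff V 1 \<in> W"
  proof (rule coeffs_in_subspace[where N = "max 2 (Suc (Polynomial.degree V))"])
    fix s :: real
    assume "s \<ge> 0"
    have "(\<Sum>m<max 2 (Suc (Polynomial.degree V)). s ^ m *\<^sub>R coeff V m) = poly V (Const s)"
      unfolding poly_altdef pow
      by (intro sum.mono_neutral_cong_right)
        (auto simp: coeff_eq_0 not_le mult.commute simp flip: Const_mult_eq_scaleR)
    then show "(\<Sum>m<max 2 (Suc (Polynomial.degree V)). s ^ m *\<^sub>R coeff V m) \<in> W"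
      using V(1)[of s] assms(1)[of s] by simp
  qed (use assms in auto)
  then show ?thesis using V(2) by simp
qed

text \<open>Closure under differentiation is what lets all iterated derivatives of \<open>p\<close>
  be reached, starting from \<open>p\<close> itself.\<close>

lemma partial_deriv_span_translates:
  assumes "i \<in> {1..n}" "x \<in> span ((\<lambda>a. translate a p) ` ({1..n} \<rightarrow>\<^sub>E UNIV))"
  shows "partial_deriv i x \<in> span ((\<lambda>a. translate a p) ` ({1..n} \<rightarrow>\<^sub>E UNIV))" (is "_ \<in> ?W")
  using assms(2)
proof (induction rule: span_induct_alt)
  case base
  show ?case using partial_deriv_scaleR[of i 0 0] by (simp add: span_zero)
next
  case (step c x y)
  then obtain a where a: "a \<in> {1..n} \<rightarrow>\<^sub>E UNIV" "x = translate a p" by blast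
  have "translate a (partial_deriv i p) \<in> ?W"
  proof (rule translate_derivative_in_span)
    fix s
    have "a(i := a i + s) \<in> {1..n} \<rightarrow>\<^sub>E UNIV"
      using a(1) assms(1) by (auto simp: PiE_def extensional_def)
    then show "translate (a(i := a i + s)) p \<in> ?W" by (intro span_base imageI)
  qed simp
  then show ?case using step(2)
    by (simp add: partial_deriv_add partial_deriv_scaleR a(2) partial_deriv_translate span_add span_scale)
qed

section \<open>Polynomials determined by their values on the orthant\<close>

lemma subst_cong:
  assumes "p \<in> polys n" "\<And>i. i \<in> {1..n} \<Longrightarrow> \<phi> i = \<phi>' i"
  shows "subst c \<phi> p = subst c \<phi>' p"
  using assms unfolding subst_def monom_subst_def polys_def
  by (intro sum.cong prod.cong arg_cong2[where f = "(*)"] arg_cong2[where f = "(^)"] refl) blast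

lemma translate_zero:
  assumes "p \<in> polys n" "\<And>i. i \<in> {1..n} \<Longrightarrow> a i = 0"
  shows "translate a p = p"
proof -
  have "translate a p = subst Const Var p"
    unfolding translate_eq_subst using assms by (intro subst_cong) (auto simp: Const_hom.c_zero)
  also have "\<dots> = p"
    by (induction p rule: mpoly_induct) (auto simp: Const_hom.subst_add Const_hom.subst_mult)
  finally show ?thesis .
qed

lemma monom_subst_zero_fun: "monom_subst (\<lambda>_. 0) m = (if m = 0 then 1 else 0 :: 'a::comm_ring_1)"
proof (cases "m = 0")
  case False
  then obtain i where "i \<in> Poly_Mapping.keys m" by fastforce
  then have "monom_subst (\<lambda>_. 0) m = (0 :: 'a)"
    unfolding monom_subst_def by (intro prod_zero bexI[of _ i]) (auto simp: in_keys_iff zero_power)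
  then show ?thesis using False by simp
qed simp

lemma eval_zero_fun: "eval (\<lambda>_. 0) p = lk p 0"
  by (simp add: eval_eq_subst subst_def monom_subst_zero_fun if_distrib in_keys_iff cong: if_cong)

text \<open>Vanishing on the orthant passes to partial derivatives, and evaluation at 0 reads off
  the constant term. Each unit of the exponent \<open>k\<close> costs one derivative, so
  \<open>p\<close> varies in the induction.\<close>

lemma eval_vanishing_imp_zero:
  assumes "\<And>t. (\<And>i. t i \<ge> 0) \<Longrightarrow> eval t p = 0"
  shows "p = 0"
proof (rule poly_mapping_eqI)
  fix k
  show "lk p k = lk 0 k"
    using assms
  proof (induction k arbitrary: p rule: exponent_induct)
    case zero
    then show ?case by (metis eval_zero_fun order_refl lookup_zero)
  next
    case (add k i)
    have "lk (partial_deriv i p) k = lk 0 k"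
      by (rule add.IH, rule eval_taylor_coeff) (auto intro!: add.prems)
    then show ?case by (simp add: lookup_partial_deriv)
  qed
qed

lemma eval_diff: "eval t (p - p') = eval t p - eval t p'"
  using real_hom.subst_add[of t "p - p'" p'] by (simp add: eval_eq_subst)

lemma polys_diff: "p \<in> polys n \<Longrightarrow> p' \<in> polys n \<Longrightarrow> p - p' \<in> polys n"
  using keys_diff[of p p'] unfolding polys_def by blast

text \<open>This gives the uniqueness behind the definite description of \<open>q\<close>.\<close>

lemma polys_eqI:
  assumes "p \<in> polys n" "p' \<in> polys n"
    and eq: "\<And>t. t \<in> {1..n} \<rightarrow>\<^sub>E {0..} \<Longrightarrow> eval t p = eval t p'"
  shows "p = p'"
proof -
  have "eval t (p - p') = 0" if "\<And>i. t i \<ge> 0" for t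
  proof -
    have "eval t (p - p') = eval (restrict t {1..n}) (p - p')"
      using assms(1,2) unfolding eval_eq_subst by (intro subst_cong[of _ n] polys_diff) auto
    also have "\<dots> = 0"
      using that eq[of "restrict t {1..n}"] by (auto simp: eval_diff)
    finally show ?thesis .
  qed
  then show ?thesis using eval_vanishing_imp_zero[of "p - p'"] by simp
qed

text \<open>Along this line the amount \<open>u\<close> moves from coordinate \<open>m\<close> to
  coordinate \<open>n\<close>, so the chain rule yields the difference of two partial derivatives.
  It serves the slicing integral for the volume.\<close>

lemma eval_has_real_derivative:
  assumes "m \<noteq> n"
  shows "((\<lambda>u. eval (t(m := c - u, n := u)) p) has_real_derivative
    eval (t(m := c - u, n := u)) (partial_deriv n p - partial_deriv m p)) (at u)"
proof -
  define \<psi> where "\<psi> = (\<lambda>u. t(m := c - u, n := u))"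
  have "((\<lambda>u. subst (\<lambda>x. x) (\<psi> u) p) has_real_derivative
      subst (\<lambda>x. x) (\<psi> u) (partial_deriv n p) - subst (\<lambda>x. x) (\<psi> u) (partial_deriv m p)) (at u)"
  proof (induction p rule: mpoly_induct)
  case (Const a)
  show ?case using real_hom.subst_Const[of _ 0] by (simp add: Const_def[of 0])
next
  case (Var j)
  show ?case using real_hom.subst_Const[of _ 0] real_hom.subst_Const[of _ 1] assms
    by (auto simp: \<psi>_def partial_deriv_Var Const_def[of 0] Const_def[of 1] intro!: derivative_eq_intros)
next
  case (add p p')
  show ?case
    unfolding real_hom.subst_add partial_deriv_add
    by (rule DERIV_cong[OF DERIV_add[OF add]]) (simp add: algebra_simps)
next
  case (mult p p')
  show ?case
    unfolding real_hom.subst_add partial_deriv_mult real_hom.subst_mult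
    by (rule DERIV_cong[OF DERIV_mult[OF mult]]) (simp add: algebra_simps)
qed
  then show ?thesis unfolding \<psi>_def eval_diff unfolding eval_eq_subst .
qed

subsection \<open>Triangular families and tail sums\<close>

text \<open>The functionals \<open>l S\<close> act as coordinates on \<open>V\<close>, and their
  matrix on the family \<open>b\<close> is unitriangular for the weight \<open>w\<close>. Spanning
  follows by clearing coordinates in order of increasing weight, independence by induction on the
  weight.\<close>

lemma triangular_family_basis:
  fixes b :: "'i \<Rightarrow> 'v::real_vector" and l :: "'i \<Rightarrow> 'v \<Rightarrow> real" and w :: "'i \<Rightarrow> nat"
  assumes fin: "finite I" and V: "subspace V" and lin: "\<And>S. S \<in> I \<Longrightarrow> linear (l S)"
    and b: "\<And>T. T \<in> I \<Longrightarrow> b T \<in> V" and diag: "\<And>T. T \<in> I \<Longrightarrow> l T (b T) = 1"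
    and tri: "\<And>S T. S \<in> I \<Longrightarrow> T \<in> I \<Longrightarrow> l S (b T) \<noteq> 0 \<Longrightarrow> S = T \<or> w T < w S"
    and sep: "\<And>p. p \<in> V \<Longrightarrow> (\<And>S. S \<in> I \<Longrightarrow> l S p = 0) \<Longrightarrow> p = 0"
  shows "span (b ` I) = V" "dim V = card I"
proof -
  obtain N where N: "\<And>S. S \<in> I \<Longrightarrow> w S < N"
    using fin finite_nat_set_iff_bounded[of "w ` I"] by auto
  have l_sum: "l S (\<Sum>T\<in>J. c T *\<^sub>R b T) = (\<Sum>T\<in>J. c T * l S (b T))" if "S \<in> I" for S J and c :: "'i \<Rightarrow> real"
    using lin[OF that] by (simp add: linear_sum linear_scale)
  \<comment> \<open>Generalised to vectors whose coordinates of weight below \<open>m\<close> are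
    already cleared; one step clears weight \<open>m\<close>, and at \<open>m = N\<close> separation
    gives zero.\<close>
  have "p \<in> span (b ` I)" if "p \<in> V" "\<forall>S\<in>I. w S < m \<longrightarrow> l S p = 0" for p m
    using that
  proof (induction "N - m" arbitrary: m p rule: less_induct)
    case less
    show ?case
    proof (cases "m < N")
      case False
      have "p = 0"
        using less.prems N False by (intro sep) (auto simp: not_less intro: less_le_trans)
      then show ?thesis by (simp add: span_zero)
    next
      case True
      define J where "J = {T \<in> I. w T = m}"
      define r where "r = (\<Sum>T\<in>J. l T p *\<^sub>R b T)"
      have r: "r \<in> span (b ` I)"
        unfolding r_def J_def by (intro span_sum span_scale span_base) auto
      have "r \<in> V"
        unfolding r_def J_def by (intro subspace_sum[OF V] subspace_scale[OF V] b) auto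
      moreover have "l S (p - r) = 0" if S: "S \<in> I" "w S < Suc m" for S
      proof -
        \<comment> \<open>For \<open>T \<noteq> S\<close> a nonzero entry would force
          \<open>w T < w S\<close>, but \<open>w S \<le> m = w T\<close>.\<close>
        have "l S r = (\<Sum>T\<in>J. if T = S then l T p else 0)"
          unfolding r_def l_sum[OF S(1)] using S tri[OF S(1)] diag
          by (intro sum.cong refl) (fastforce simp: J_def)
        also have "\<dots> = l S p"
          using fin S less.prems by (cases "w S = m") (auto simp: J_def)
        finally show ?thesis using lin[OF S(1)] by (simp add: linear_diff)
      qed
      ultimately have "p - r \<in> span (b ` I)"
        using True less.prems(1) V by (intro less.hyps[of "Suc m"]) (auto intro: subspace_diff)
      then have "p - r + r \<in> span (b ` I)" using r by (intro span_add)
      then show ?thesis by simp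
    qed
  qed
  from this[of _ 0] have "V \<subseteq> span (b ` I)" by auto
  then show span: "span (b ` I) = V"
    using span_minimal[of "b ` I" V] b V by auto
  have inj: "inj_on b I"
  proof (rule inj_onI)
    fix S T
    assume "S \<in> I" "T \<in> I" "b S = b T"
    then show "S = T"
      using tri[of S T] tri[of T S] diag[of S] diag[of T] by fastforce
  qed
  have "independent (b ` I)"
  proof (rule independent_if_scalars_zero)
    fix f x
    assume "(\<Sum>x\<in>b ` I. f x *\<^sub>R x) = 0" and x: "x \<in> b ` I"
    then have sum0: "(\<Sum>T\<in>I. f (b T) *\<^sub>R b T) = 0"
      using inj by (simp add: sum.reindex)
    have "f (b T) = 0" if "T \<in> I" for T
      using that
    proof (induction "w T" arbitrary: T rule: less_induct)
      case less
      have "0 = (\<Sum>S\<in>I. f (b S) * l T (b S))"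
        using l_sum[OF less.prems, of "\<lambda>S. f (b S)" I] sum0 linear_0[OF lin[OF less.prems]] by simp
      \<comment> \<open>Terms with \<open>w S < w T\<close> vanish by induction, the other
        off-diagonal ones by triangularity.\<close>
      also have "\<dots> = (\<Sum>S\<in>I. if S = T then f (b T) else 0)"
        using less.hyps tri[OF less.prems] diag by (intro sum.cong refl) fastforce
      also have "\<dots> = f (b T)" using fin less.prems by simp
      finally show ?case by simp
    qed
    then show "f x = 0" using x by blast
  qed (use fin in simp)
  then have "dim V = card (b ` I)"
    using span by (intro dim_eq_card) (auto simp: span_span)
  then show "dim V = card I" using inj by (simp add: card_image)
qed

text \<open>Summation by parts: \<open>f i\<close> occurs in exactly the \<open>i\<close> tails
  starting at \<open>1, ..., i\<close>.\<close>

lemma weighted_sum_tails: "(\<Sum>i=1..n. i * f i) = (\<Sum>m=1..n. \<Sum>i=m..n. f i :: nat)"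
proof (induction n)
  case (Suc n)
  have "(\<Sum>m=1..Suc n. \<Sum>i=m..Suc n. f i) = (\<Sum>m=1..n. (\<Sum>i=m..n. f i) + f (Suc n)) + f (Suc n)"
    by (auto intro!: sum.cong)
  then show ?case using Suc by (simp add: sum.distrib)
qed simp

text \<open>The weights are sums of tails. If they agreed, the termwise inequality would make all
  tails equal, and differences of consecutive tails would give \<open>f = g\<close>.\<close>

lemma weighted_sum_less:
  fixes f g :: "nat \<Rightarrow> nat"
  assumes le: "\<And>m. m \<in> {1..n} \<Longrightarrow> (\<Sum>i=m..n. g i) \<le> (\<Sum>i=m..n. f i)"
    and neq: "\<exists>i\<in>{1..n}. f i \<noteq> g i"
  shows "(\<Sum>i=1..n. i * g i) < (\<Sum>i=1..n. i * f i)"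
proof -
  have "(\<Sum>m=1..n. \<Sum>i=m..n. g i) \<noteq> (\<Sum>m=1..n. \<Sum>i=m..n. f i)"
  proof
    assume "(\<Sum>m=1..n. \<Sum>i=m..n. g i) = (\<Sum>m=1..n. \<Sum>i=m..n. f i)"
    then have tails: "(\<Sum>i=m..n. g i) = (\<Sum>i=m..n. f i)" if "m \<in> {1..n}" for m
      using sum_mono_inv[of "\<lambda>m. \<Sum>i=m..n. g i" "{1..n}" "\<lambda>m. \<Sum>i=m..n. f i" m] le that by auto
    have "f m = g m" if "m \<in> {1..n}" for m
    proof -
      have "(\<Sum>i=Suc m..n. g i) = (\<Sum>i=Suc m..n. f i)"
        using tails[of "Suc m"] by (cases "Suc m \<le> n") auto
      then show ?thesis
        using tails[of m] that by (simp add: sum.atLeast_Suc_atMost)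
    qed
    then show False using neq by blast
  qed
  moreover have "(\<Sum>m=1..n. \<Sum>i=m..n. g i) \<le> (\<Sum>m=1..n. \<Sum>i=m..n. f i)"
    by (intro sum_mono le)
  ultimately show ?thesis unfolding weighted_sum_tails by simp
qed

subsection \<open>Scaled coefficients\<close>

definition fact_exp :: "(nat \<Rightarrow>\<^sub>0 nat) \<Rightarrow> real" where
  "fact_exp k = (\<Prod>i\<in>Poly_Mapping.keys k. fact (lk k i))"

text \<open>This is the value at 0 of the iterated derivative of \<open>p\<close> with multi-index
  \<open>k\<close>.\<close>

definition scoeff :: "mpoly \<Rightarrow> (nat \<Rightarrow>\<^sub>0 nat) \<Rightarrow> real" where
  "scoeff p k = fact_exp k * lk p k"

lemma fact_exp_pos: "fact_exp k > 0"
  by (simp add: fact_exp_def prod_pos)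

lemma keys_add_unit: "Poly_Mapping.keys (k + unit_exp i) = insert i (Poly_Mapping.keys k)"
  by (auto simp: in_keys_iff lookup_add lookup_single when_def split: if_splits)

lemma fact_exp_add_unit: "fact_exp (k + unit_exp i) = real (lk k i + 1) * fact_exp k"
proof -
  \<comment> \<open>Splitting off \<open>i\<close> treats both cases alike: if \<open>i\<close> is
    not a key of \<open>k\<close>, its factor is \<open>fact 0 = 1\<close>.\<close>
  let ?A = "Poly_Mapping.keys k - {i}"
  have "fact_exp k = (\<Prod>j\<in>insert i ?A. fact (lk k j))"
    unfolding fact_exp_def by (intro prod.mono_neutral_left) (auto simp: in_keys_iff)
  then have "fact_exp k = fact (lk k i) * (\<Prod>j\<in>?A. fact (lk k j))"
    by (subst (asm) prod.insert) auto
  moreover have "fact_exp (k + unit_exp i) = fact (lk (k + unit_exp i) i) * (\<Prod>j\<in>?A. fact (lk (k + unit_exp i) j))"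
    unfolding fact_exp_def keys_add_unit by (subst prod.insert_remove) auto
  moreover have "(\<Prod>j\<in>?A. fact (lk (k + unit_exp i) j)) = (\<Prod>j\<in>?A. fact (lk k j) :: real)"
    by (intro prod.cong) (auto simp: lookup_add lookup_single when_def)
  ultimately show ?thesis by (simp add: lookup_add algebra_simps)
qed

lemma scoeff_partial_deriv: "scoeff (partial_deriv i p) k = scoeff p (k + unit_exp i)"
  by (simp add: scoeff_def lookup_partial_deriv fact_exp_add_unit)

lemma scoeff_simps:
  "scoeff 0 k = 0" "scoeff (p + p') k = scoeff p k + scoeff p' k"
  "scoeff (p - p') k = scoeff p k - scoeff p' k" "scoeff (a *\<^sub>R p) k = a * scoeff p k"
  by (simp_all add: scoeff_def lookup_add lookup_minus distrib_left right_diff_distrib)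

lemma linear_scoeff: "linear (\<lambda>p. scoeff p k)"
  by (rule linearI) (simp_all add: scoeff_simps)

lemma scoeff_eqI:
  assumes "\<And>k. scoeff p k = scoeff p' k"
  shows "p = p'"
proof (rule poly_mapping_eqI)
  fix k
  show "lk p k = lk p' k"
    using assms[of k] fact_exp_pos[of k] by (simp add: scoeff_def)
qed

lemma in_keys_iff_scoeff: "k \<in> Poly_Mapping.keys p \<longleftrightarrow> scoeff p k \<noteq> 0"
  using fact_exp_pos[of k] by (auto simp: scoeff_def in_keys_iff)

lemma scoeff_D: "scoeff (D i p) k = (if i = 0 then 0 else scoeff p (k + unit_exp i))"
  by (simp add: D_def scoeff_partial_deriv scoeff_simps)

text \<open>The operator equations become shift relations on scaled coefficients; the case
  \<open>i = 1\<close> has right side 0 because \<open>D 0\<close> is zero.\<close>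

lemma annihilated_iff: "annihilated n p \<longleftrightarrow> (\<forall>i\<in>{1..n}. \<forall>k. scoeff p (k + unit_exp i + unit_exp i) =
    (if i = 1 then 0 else scoeff p (k + unit_exp i + unit_exp (i - 1))))"
proof -
  have "D i (D i p - D (i - 1) p) = 0 \<longleftrightarrow> (\<forall>k. scoeff p (k + unit_exp i + unit_exp i) =
    (if i = 1 then 0 else scoeff p (k + unit_exp i + unit_exp (i - 1))))" if "i \<in> {1..n}" for i
  proof -
    have "D i (D i p - D (i - 1) p) = 0 \<longleftrightarrow> (\<forall>k. scoeff (D i (D i p - D (i - 1) p)) k = 0)"
      using scoeff_eqI[of _ 0] by (auto simp: scoeff_simps)
    then show ?thesis using that by (auto simp: scoeff_D scoeff_simps)
  qed
  then show ?thesis by (simp add: annihilated_def)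
qed

lemma in_P_iff: "p \<in> P n j \<longleftrightarrow>
    (\<forall>k. scoeff p k \<noteq> 0 \<longrightarrow> Poly_Mapping.keys k \<subseteq> {1..n} \<and> (\<Sum>i=1..n. lk k i) = j) \<and> annihilated n p"
proof -
  have "(\<Sum>i\<in>Poly_Mapping.keys k. lk k i) = (\<Sum>i=1..n. lk k i)" if "Poly_Mapping.keys k \<subseteq> {1..n}" for k
    using that by (intro sum.mono_neutral_left) (auto simp: in_keys_iff)
  then show ?thesis
    unfolding P_def polys_def homogeneous_def in_keys_iff_scoeff mem_Collect_eq Ball_def by metis
qed

lemma subspace_P: "subspace (P n j)"
proof (rule subspaceI)
  show "0 \<in> P n j" by (simp add: in_P_iff annihilated_iff scoeff_simps)
next
  fix p p'
  assume p: "p \<in> P n j" "p' \<in> P n j"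
  then have "annihilated n (p + p')"
    by (simp add: in_P_iff annihilated_iff scoeff_simps)
  moreover have "scoeff p k \<noteq> 0 \<or> scoeff p' k \<noteq> 0" if "scoeff (p + p') k \<noteq> 0" for k
    using that by (auto simp: scoeff_simps)
  ultimately show "p + p' \<in> P n j" using p unfolding in_P_iff by blast
next
  fix a p
  assume "p \<in> P n j"
  then show "a *\<^sub>R p \<in> P n j"
    by (simp add: in_P_iff annihilated_iff scoeff_simps)
qed

text \<open>The exponent of the squarefree monomial with variable set \<open>S\<close>.\<close>

definition ind_exp :: "nat set \<Rightarrow> (nat \<Rightarrow>\<^sub>0 nat)" where
  "ind_exp S = (\<Sum>i\<in>S. unit_exp i)"

lemma lookup_ind_exp: "finite S \<Longrightarrow> lk (ind_exp S) i = of_bool (i \<in> S)"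
  by (simp add: ind_exp_def lookup_sum lookup_single when_def)

lemma sum_add_unit: "finite A \<Longrightarrow> (\<Sum>x\<in>A. lk (k + unit_exp i) x) = (\<Sum>x\<in>A. lk k x) + of_bool (i \<in> A)"
  by (simp add: lookup_add lookup_single when_def sum.distrib)

text \<open>The operators rewrite \<open>t\<^sub>i\<^sup>2\<close> to \<open>t\<^sub>i t\<^sub>i\<^sub>-\<^sub>1\<close>, which lowers \<open>\<Sum>i. i * k\<^sub>i\<close> until the exponent \<open>k\<close> is squarefree.\<close>

lemma P_squarefree_determined:
  assumes p: "p \<in> P n j"
    and sqfree: "\<And>S. S \<subseteq> {1..n} \<Longrightarrow> card S = j \<Longrightarrow> scoeff p (ind_exp S) = 0"
  shows "p = 0"
proof (rule scoeff_eqI)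
  fix k
  have supp: "Poly_Mapping.keys k \<subseteq> {1..n} \<and> (\<Sum>i=1..n. lk k i) = j" if "scoeff p k \<noteq> 0" for k
    using p that in_P_iff by blast
  have "scoeff p k = 0"
  proof (induction "\<Sum>i=1..n. i * lk k i" arbitrary: k rule: less_induct)
    case less
    show ?case
    proof (rule ccontr)
      assume nz: "scoeff p k \<noteq> 0"
      note keys = supp[OF nz]
      show False
      proof (cases "\<exists>i. lk k i \<ge> 2")
        case True
        then obtain i where i: "lk k i \<ge> 2" by blast
        then have "i \<in> Poly_Mapping.keys k" by (auto simp: in_keys_iff)
        then have i_in: "i \<in> {1..n}" using keys by blast
        define k' where "k' = k - unit_exp i - unit_exp i"
        have k: "k = k' + unit_exp i + unit_exp i"
          using i by (intro poly_mapping_eqI)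
            (auto simp: k'_def lookup_add lookup_minus lookup_single when_def)
        have eq: "scoeff p k = (if i = 1 then 0 else scoeff p (k' + unit_exp i + unit_exp (i - 1)))"
          using p i_in unfolding in_P_iff annihilated_iff k by blast
        then have "i \<noteq> 1" using nz by auto
        have weight: "(\<Sum>x=1..n. x * lk (l + unit_exp i) x) = (\<Sum>x=1..n. x * lk l x) + i"
          if "i \<in> {1..n}" for l i
        proof -
          have "x * lk (l + unit_exp i) x = x * lk l x + (if x = i then i else 0)" for x
            by (simp add: lookup_add lookup_single when_def)
          then show ?thesis using that by (simp add: sum.distrib)
        qed
        \<comment> \<open>The weight drops by exactly one, from a contribution of
          \<open>2 * i\<close> to \<open>i + (i - 1)\<close>.\<close>
        have "(\<Sum>x=1..n. x * lk (k' + unit_exp i + unit_exp (i - 1)) x) < (\<Sum>x=1..n. x * lk k x)"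
        proof -
          have "i - 1 \<in> {1..n}" using i_in \<open>i \<noteq> 1\<close> by auto
          then show ?thesis using i_in by (simp add: weight k del: One_nat_def)
        qed
        then show False using less eq nz \<open>i \<noteq> 1\<close> by auto
      next
        case False
        have "lk k i = of_bool (i \<in> Poly_Mapping.keys k)" for i
          using False[simplified, rule_format, of i] by (auto simp: in_keys_iff)
        then have k: "k = ind_exp (Poly_Mapping.keys k)"
          by (intro poly_mapping_eqI) (simp add: lookup_ind_exp)
        have "j = (\<Sum>i\<in>Poly_Mapping.keys k. lk k i)"
          using keys by (auto simp: in_keys_iff intro!: sum.mono_neutral_right)
        also have "\<dots> = (\<Sum>i\<in>Poly_Mapping.keys k. 1)"
          using \<open>\<And>i. lk k i = of_bool (i \<in> Poly_Mapping.keys k)\<close> by (intro sum.cong) auto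
        finally have "scoeff p (ind_exp (Poly_Mapping.keys k)) = 0"
          using keys by (intro sqfree) auto
        then show False using k nz by simp
      qed
    qed
  qed
  then show "scoeff p k = scoeff 0 k" by (simp add: scoeff_simps)
qed

subsection \<open>The volume polynomial\<close>

text \<open>Read from the last entry backwards, these are ballot sequences: the last
  \<open>m\<close> entries sum to at least \<open>m\<close>. For \<open>n = 2\<close> they are the
  exponents of \<open>t\<^sub>2\<^sup>2\<close> and \<open>t\<^sub>1 t\<^sub>2\<close>.\<close>

definition sp_exps :: "nat \<Rightarrow> (nat \<Rightarrow>\<^sub>0 nat) set" where
  "sp_exps n = {k. Poly_Mapping.keys k \<subseteq> {1..n} \<and> (\<Sum>i=1..n. lk k i) = n \<and>
     (\<forall>j\<in>{1..n}. n + 1 \<le> j + (\<Sum>i=j..n. lk k i))}"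

definition sp_poly :: "nat \<Rightarrow> mpoly" where
  "sp_poly n = (\<Sum>k\<in>sp_exps n. Poly_Mapping.single k (1 / fact_exp k))"

lemma finite_sp_exps: "finite (sp_exps n)"
proof (rule inj_on_finite)
  show "inj_on lk (sp_exps n)" by (simp add: inj_on_def)
  have "lk k i \<le> n" if "k \<in> sp_exps n" "i \<in> {1..n}" for k i
    using that member_le_sum[of i "{1..n}" "lk k"] by (auto simp: sp_exps_def)
  then show "lk ` sp_exps n \<subseteq> {f. \<forall>x. (x \<in> {1..n} \<longrightarrow> f x \<in> {..n}) \<and> (x \<notin> {1..n} \<longrightarrow> f x = 0)}"
    by (auto simp: sp_exps_def in_keys_iff subset_iff)
  show "finite {f. \<forall>x. (x \<in> {1..n} \<longrightarrow> f x \<in> {..n}) \<and> (x \<notin> {1..n} \<longrightarrow> f x = 0)}"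
    by (rule finite_set_of_finite_funs) auto
qed

lemma scoeff_sp_poly: "scoeff (sp_poly n) k = of_bool (k \<in> sp_exps n)"
  using fact_exp_pos[of k] finite_sp_exps
  by (auto simp: scoeff_def sp_poly_def lookup_sum lookup_single when_def)

text \<open>Moving a unit from \<open>i\<close> to \<open>i - 1\<close> lowers only the tail at
  \<open>i\<close>. Its bound survives because the tail at \<open>i + 1\<close> is at least
  \<open>n - i\<close> and one unit stays at \<open>i\<close>. For \<open>i = 1\<close>, two units
  at 1 leave at most \<open>n - 2\<close> for the tail at 2, which needs
  \<open>n - 1\<close>.\<close>

lemma sp_exps_shift:
  assumes i: "i \<in> {1..n}"
  shows "k + unit_exp i + unit_exp i \<in> sp_exps n \<longleftrightarrow> i \<noteq> 1 \<and> k + unit_exp i + unit_exp (i - 1) \<in> sp_exps n"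
proof (cases "i = 1")
  case True
  have False if "k + unit_exp 1 + unit_exp 1 \<in> sp_exps n"
  proof -
    have "(\<Sum>i=1..n. lk k i) + 2 = n"
      using that i by (simp add: sp_exps_def sum_add_unit)
    \<comment> \<open>The total forces \<open>n \<ge> 2\<close>, so the tail condition at 2 is
      available.\<close>
    moreover from this have "n + 1 \<le> 2 + (\<Sum>i=2..n. lk (k + unit_exp 1 + unit_exp 1) i)"
      using that unfolding sp_exps_def by (metis (lifting) atLeastAtMost_iff le_add2 mem_Collect_eq one_le_numeral)
    then have "n + 1 \<le> 2 + (\<Sum>i=2..n. lk k i)"
      by (simp add: sum_add_unit)
    moreover have "(\<Sum>i=2..n. lk k i) \<le> (\<Sum>i=1..n. lk k i)" by (intro sum_mono2) auto
    ultimately show False by linarith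
  qed
  then show ?thesis using True by auto
next
  case False
  let ?t = "\<lambda>j. \<Sum>x=j..n. lk k x"
  let ?m = "k + unit_exp i"
  have keys: "Poly_Mapping.keys (?m + unit_exp i) \<subseteq> {1..n} \<longleftrightarrow> Poly_Mapping.keys (?m + unit_exp (i - 1)) \<subseteq> {1..n}"
    using i False by (auto simp: keys_add_unit)
  have total: "(\<Sum>x=1..n. lk (?m + unit_exp i) x) = (\<Sum>x=1..n. lk (?m + unit_exp (i - 1)) x)"
    using i False by (auto simp: sum_add_unit)
  have tails: "(\<forall>j\<in>{1..n}. n + 1 \<le> j + (\<Sum>x=j..n. lk (?m + unit_exp i) x)) \<longleftrightarrow>
      (\<forall>j\<in>{1..n}. n + 1 \<le> j + (\<Sum>x=j..n. lk (?m + unit_exp (i - 1)) x))" (is "?L \<longleftrightarrow> ?R")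
  proof
    assume L: ?L
    have "n + 1 \<le> i + 1 + ?t i"
    proof (cases "i = n")
      case False
      have "n + 1 \<le> Suc i + ?t (Suc i)"
        using L[rule_format, of "Suc i"] i False by (simp add: sum_add_unit)
      also have "?t (Suc i) \<le> ?t i" by (intro sum_mono2) auto
      finally show ?thesis by simp
    qed auto
    show ?R
    proof
      fix j
      assume j: "j \<in> {1..n}"
      then have "n + 1 \<le> j + (?t j + of_bool (i \<in> {j..n}) + of_bool (i \<in> {j..n}))"
        using L by (simp add: sum_add_unit)
      then show "n + 1 \<le> j + (\<Sum>x=j..n. lk (?m + unit_exp (i - 1)) x)"
        using \<open>n + 1 \<le> i + 1 + ?t i\<close> i j by (cases "i = j") (auto simp: sum_add_unit)
    qed
  next
    assume R: ?R
    show ?L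
    proof
      fix j
      assume "j \<in> {1..n}"
      then show "n + 1 \<le> j + (\<Sum>x=j..n. lk (?m + unit_exp i) x)"
        using R[rule_format, of j] i by (auto simp: sum_add_unit of_bool_def split: if_splits)
    qed
  qed
  show ?thesis using keys total tails False by (simp add: sp_exps_def)
qed

lemma annihilated_sp_poly: "annihilated n (sp_poly n)"
  unfolding annihilated_iff scoeff_sp_poly by (auto simp: sp_exps_shift simp del: One_nat_def)

lemma sp_poly_in_P: "sp_poly n \<in> P n n"
  using annihilated_sp_poly by (auto simp: in_P_iff scoeff_sp_poly sp_exps_def)

lemma sp_poly_in_polys: "sp_poly n \<in> polys n"
  using sp_poly_in_P by (simp add: P_def)

text \<open>With \<open>n' = n - 1\<close>, the three memberships reduce to the same conditions and
  differ only in \<open>lk k n\<close>: arbitrary in \<open>A\<close>, positive in \<open>B\<close>,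
  zero in \<open>C\<close>. So the indicator of \<open>C\<close> is that of \<open>A\<close> minus
  that of \<open>B\<close>; for \<open>n = 1\<close> there is no \<open>B\<close>, matching
  \<open>D 0\<close>.\<close>

lemma sp_exps_recurrence:
  assumes "n \<ge> 1"
  shows "k \<in> sp_exps (n - 1) \<longleftrightarrow> k + unit_exp n \<in> sp_exps n \<and> (n = 1 \<or> k + unit_exp (n - 1) \<notin> sp_exps n)"
    and "n \<noteq> 1 \<Longrightarrow> k + unit_exp (n - 1) \<in> sp_exps n \<Longrightarrow> k + unit_exp n \<in> sp_exps n"
proof -
  obtain n' where n: "n = Suc n'" using assms by (cases n) auto
  have S: "(\<Sum>i=j..n. lk l i) = (\<Sum>i=j..n'. lk l i) + lk l n" if "j \<le> n" for j and l :: "nat \<Rightarrow>\<^sub>0 nat"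
    using that by (simp add: n)
  have L: "lk (k + unit_exp i) n = lk k n + of_bool (i = n)" for i
    by (simp add: lookup_add lookup_single when_def)
  have ball: "(\<forall>j\<in>{1..n}. R j) \<longleftrightarrow> (\<forall>j\<in>{1..n'}. R j) \<and> R n" for R
  proof -
    have "{1..n} = insert n {1..n'}" using n by auto
    then show ?thesis by auto
  qed
  have A: "k + unit_exp n \<in> sp_exps n \<longleftrightarrow> Poly_Mapping.keys k \<subseteq> {1..n} \<and> (\<Sum>i=1..n'. lk k i) + lk k n = n' \<and>
     (\<forall>j\<in>{1..n'}. n \<le> j + (\<Sum>i=j..n'. lk k i) + lk k n)"
  proof -
    have T: "(\<Sum>i=j..n. lk (k + unit_exp n) i) = (\<Sum>i=j..n'. lk k i) + lk k n + 1" if "j \<le> n" for j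
      using that sum_add_unit[of "{j..n}" k n] S[OF that, of k] by simp
    have keys: "Poly_Mapping.keys (k + unit_exp n) \<subseteq> {1..n} \<longleftrightarrow> Poly_Mapping.keys k \<subseteq> {1..n}"
      using n by (auto simp: keys_add_unit)
    have total: "(\<Sum>i=1..n. lk (k + unit_exp n) i) = n \<longleftrightarrow> (\<Sum>i=1..n'. lk k i) + lk k n = n'"
      using T[of 1] n by simp
    have tails: "(\<forall>j\<in>{1..n'}. n + 1 \<le> j + (\<Sum>i=j..n. lk (k + unit_exp n) i)) \<longleftrightarrow>
        (\<forall>j\<in>{1..n'}. n \<le> j + (\<Sum>i=j..n'. lk k i) + lk k n)"
      by (rule ball_cong[OF refl], subst T) (auto simp: n)
    have "n + 1 \<le> n + (\<Sum>i=n..n. lk (k + unit_exp n) i)"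
      using L[of n] by simp
    then show ?thesis unfolding sp_exps_def mem_Collect_eq ball keys total tails by blast
  qed
  have B: "k + unit_exp n' \<in> sp_exps n \<longleftrightarrow> Poly_Mapping.keys k \<subseteq> {1..n} \<and> (\<Sum>i=1..n'. lk k i) + lk k n = n' \<and>
     (\<forall>j\<in>{1..n'}. n \<le> j + (\<Sum>i=j..n'. lk k i) + lk k n) \<and> lk k n \<ge> 1" if "n' \<ge> 1"
  proof -
    have T: "(\<Sum>i=j..n. lk (k + unit_exp n') i) = (\<Sum>i=j..n'. lk k i) + lk k n + 1" if "j \<le> n'" for j
      using that sum_add_unit[of "{j..n}" k n'] S[of j k] n by simp
    have keys: "Poly_Mapping.keys (k + unit_exp n') \<subseteq> {1..n} \<longleftrightarrow> Poly_Mapping.keys k \<subseteq> {1..n}"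
      using n that by (auto simp: keys_add_unit)
    have total: "(\<Sum>i=1..n. lk (k + unit_exp n') i) = n \<longleftrightarrow> (\<Sum>i=1..n'. lk k i) + lk k n = n'"
      using T[of 1] n that by simp
    have tails: "(\<forall>j\<in>{1..n'}. n + 1 \<le> j + (\<Sum>i=j..n. lk (k + unit_exp n') i)) \<longleftrightarrow>
        (\<forall>j\<in>{1..n'}. n \<le> j + (\<Sum>i=j..n'. lk k i) + lk k n)"
      by (rule ball_cong[OF refl], subst T) (auto simp: n)
    have "n + 1 \<le> n + (\<Sum>i=n..n. lk (k + unit_exp n') i) \<longleftrightarrow> lk k n \<ge> 1"
      using L[of n'] n by simp
    then show ?thesis unfolding sp_exps_def mem_Collect_eq ball keys total tails by blast
  qed
  have C: "k \<in> sp_exps n' \<longleftrightarrow> Poly_Mapping.keys k \<subseteq> {1..n} \<and> (\<Sum>i=1..n'. lk k i) + lk k n = n' \<and>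
     (\<forall>j\<in>{1..n'}. n \<le> j + (\<Sum>i=j..n'. lk k i) + lk k n) \<and> lk k n = 0"
  proof -
    have "Poly_Mapping.keys k \<subseteq> {1..n'} \<longleftrightarrow> Poly_Mapping.keys k \<subseteq> {1..n} \<and> lk k n = 0"
    proof -
      have "{1..n'} = {1..n} - {n}" using n by auto
      then show ?thesis by (metis in_keys_iff subset_Diff_insert Diff_empty)
    qed
    then show ?thesis by (auto simp: sp_exps_def n)
  qed
  show "k \<in> sp_exps (n - 1) \<longleftrightarrow> k + unit_exp n \<in> sp_exps n \<and> (n = 1 \<or> k + unit_exp (n - 1) \<notin> sp_exps n)"
  proof (cases "n' = 0")
    case True
    then show ?thesis using A C n by auto
  next
    case False
    then show ?thesis using A B C n by auto
  qed
  show "n \<noteq> 1 \<Longrightarrow> k + unit_exp (n - 1) \<in> sp_exps n \<Longrightarrow> k + unit_exp n \<in> sp_exps n"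
    using A B n by auto
qed

lemma sp_poly_recurrence:
  assumes "n \<ge> 1"
  shows "partial_deriv n (sp_poly n) - D (n - 1) (sp_poly n) = sp_poly (n - 1)"
  using assms sp_exps_recurrence[OF assms]
  by (intro scoeff_eqI) (auto simp: scoeff_simps scoeff_D scoeff_partial_deriv scoeff_sp_poly)

section \<open>Derivatives of the volume polynomial as a basis\<close>

lemma iterated_derivative_in_span:
  assumes "A \<subseteq> {1..n}"
  shows "\<exists>b\<in>span ((\<lambda>a. translate a (sp_poly n)) ` ({1..n} \<rightarrow>\<^sub>E UNIV)).
    \<forall>k. scoeff b k = of_bool (k + ind_exp A \<in> sp_exps n)"
proof -
  have "finite A" using assms finite_subset by blast
  then show ?thesis using assms
  proof (induction A rule: finite_induct)
    case empty
    \<comment> \<open>The polynomial is its own translate by the zero vector, restricted so as to be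
      a point of the index space.\<close>
    have "sp_poly n = translate (restrict (\<lambda>_. 0) {1..n}) (sp_poly n)"
      by (rule translate_zero[OF sp_poly_in_polys, symmetric]) auto
    then have "sp_poly n \<in> span ((\<lambda>a. translate a (sp_poly n)) ` ({1..n} \<rightarrow>\<^sub>E UNIV))"
      by (intro span_base image_eqI) auto
    then show ?case by (rule rev_bexI) (simp add: ind_exp_def scoeff_sp_poly)
  next
    case (insert i A)
    then obtain b where b: "b \<in> span ((\<lambda>a. translate a (sp_poly n)) ` ({1..n} \<rightarrow>\<^sub>E UNIV))"
      "\<forall>k. scoeff b k = of_bool (k + ind_exp A \<in> sp_exps n)" by auto
    have "scoeff (partial_deriv i b) k = of_bool (k + ind_exp (insert i A) \<in> sp_exps n)" for k
      using b(2) insert.hyps by (simp add: scoeff_partial_deriv ind_exp_def add.assoc)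
    then show ?case using partial_deriv_span_translates[OF _ b(1)] insert.prems by blast
  qed
qed

lemma P_basis:
  obtains b :: "nat set \<Rightarrow> mpoly" where "\<And>T. b T \<in> span ((\<lambda>a. translate a (sp_poly n)) ` ({1..n} \<rightarrow>\<^sub>E UNIV))"
    "\<And>j. span (b ` {T. T \<subseteq> {1..n} \<and> card T = j}) = P n j"
    "\<And>j. dim (P n j) = n choose j"
    "b {1..n} = sp_poly n"
proof -
  \<comment> \<open>Differentiating over the complement of \<open>T\<close> leaves degree
    \<open>card T\<close>, and \<open>T = {1..n}\<close> gives the volume polynomial itself.\<close>
  have "\<forall>T. \<exists>x. x \<in> span ((\<lambda>a. translate a (sp_poly n)) ` ({1..n} \<rightarrow>\<^sub>E UNIV)) \<and>
      (\<forall>k. scoeff x k = of_bool (k + ind_exp ({1..n} - T) \<in> sp_exps n))"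
    using iterated_derivative_in_span[OF Diff_subset] by blast
  from choice[OF this] obtain b where
    b_span: "\<And>T. b T \<in> span ((\<lambda>a. translate a (sp_poly n)) ` ({1..n} \<rightarrow>\<^sub>E UNIV))"
    and b: "\<And>T k. scoeff (b T) k = of_bool (k + ind_exp ({1..n} - T) \<in> sp_exps n)"
    by blast
  \<comment> \<open>\<open>T\<close> and its complement fill \<open>{m..n}\<close>, so the tail
    bound on the shifted exponent says that the tail of \<open>k\<close> is at least
    \<open>card (T \<inter> {m..n})\<close>.\<close>
  have sums: "(\<Sum>i=m..n. lk (k + ind_exp ({1..n} - T)) i) + card (T \<inter> {m..n}) =
      (\<Sum>i=m..n. lk k i) + (n + 1 - m)" if "T \<subseteq> {1..n}" "m \<ge> 1" for k T m
  proof -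
    have "(\<Sum>i=m..n. lk (k + ind_exp ({1..n} - T)) i) = (\<Sum>i=m..n. lk k i) + card ({m..n} - T)"
      using that by (auto simp: lookup_add sum.distrib lookup_ind_exp sum.If_cases of_bool_def
        intro!: arg_cong[where f = card])
    moreover have "card ({m..n} - T) + card (T \<inter> {m..n}) = n + 1 - m"
      using card_Int_Diff[of "{m..n}" T] by (simp add: Int_commute add.commute)
    ultimately show ?thesis by simp
  qed
  have ind_sum: "(\<Sum>i=m..n. lk (ind_exp S) i) = card (S \<inter> {m..n})" if "S \<subseteq> {1..n}" for S m
  proof -
    have "finite S" using that finite_subset by blast
    then show ?thesis by (simp add: lookup_ind_exp of_bool_def sum.If_cases Int_commute)
  qed
  have card_1n: "card (T \<inter> {1..n}) = card T" if "T \<subseteq> {1..n}" for T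
    using that by (simp add: Int_absorb2)
  have keys: "Poly_Mapping.keys (k + ind_exp ({1..n} - T)) \<subseteq> {1..n} \<longleftrightarrow> Poly_Mapping.keys k \<subseteq> {1..n}" for k T
    by (auto simp: in_keys_iff lookup_add lookup_ind_exp subset_iff split: if_splits)
  have b_in: "b T \<in> P n j" if T: "T \<subseteq> {1..n}" "card T = j" for T j
    unfolding in_P_iff
  proof (intro conjI allI impI)
    fix k
    assume "scoeff (b T) k \<noteq> 0"
    then have "k + ind_exp ({1..n} - T) \<in> sp_exps n" using b T by auto
    then have k: "Poly_Mapping.keys (k + ind_exp ({1..n} - T)) \<subseteq> {1..n}"
        "(\<Sum>i=1..n. lk (k + ind_exp ({1..n} - T)) i) = n"
      unfolding sp_exps_def by blast+
    show "Poly_Mapping.keys k \<subseteq> {1..n}" using k(1) keys by blast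
    show "(\<Sum>i=1..n. lk k i) = j"
      using k(2) sums[OF T(1), of 1 k] card_1n[OF T(1)] T(2) by linarith
  next
    let ?d = "ind_exp ({1..n} - T)"
    \<comment> \<open>Constant-coefficient operators commute with derivatives: the shift relations
      hold at every exponent, in particular at \<open>k + ?d\<close>.\<close>
    have "k + unit_exp i + unit_exp i' + ?d = (k + ?d) + unit_exp i + unit_exp i'" for k i i'
      by (simp add: ac_simps)
    then show "annihilated n (b T)"
      using annihilated_sp_poly[of n] unfolding annihilated_iff b scoeff_sp_poly by presburger
  qed
  have dominance: "card (T \<inter> {m..n}) \<le> card (S \<inter> {m..n})"
    if "T \<subseteq> {1..n}" "S \<subseteq> {1..n}" "scoeff (b T) (ind_exp S) \<noteq> 0" "m \<in> {1..n}" for S T m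
  proof -
    have "n + 1 \<le> m + (\<Sum>i=m..n. lk (ind_exp S + ind_exp ({1..n} - T)) i)"
      using that by (simp add: b sp_exps_def)
    then show ?thesis
      using sums[OF that(1), of m "ind_exp S"] ind_sum[OF that(2), of m] that(4) by auto
  qed
  have tri: "S = T \<or> (\<Sum>i=1..n. i * lk (ind_exp T) i) < (\<Sum>i=1..n. i * lk (ind_exp S) i)"
    if TS: "T \<subseteq> {1..n}" "S \<subseteq> {1..n}" "scoeff (b T) (ind_exp S) \<noteq> 0" for S T
  proof (rule disjCI)
    assume "\<not> (\<Sum>i=1..n. i * lk (ind_exp T) i) < (\<Sum>i=1..n. i * lk (ind_exp S) i)"
    then have "\<forall>i\<in>{1..n}. lk (ind_exp S) i = lk (ind_exp T) i"
      using weighted_sum_less[of n "lk (ind_exp T)" "lk (ind_exp S)"] dominance[OF TS] ind_sum TS by auto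
    moreover have "finite S" "finite T" using TS finite_subset by auto
    ultimately have "\<forall>i\<in>{1..n}. i \<in> S \<longleftrightarrow> i \<in> T"
      by (simp add: lookup_ind_exp del: of_bool_eq) (metis of_bool_eq_iff)
    then show "S = T" using TS by blast
  qed
  have diag: "scoeff (b T) (ind_exp T) = 1" if T: "T \<subseteq> {1..n}" for T
  proof -
    \<comment> \<open>The two indicators add up to the all-ones exponent, for which every tail bound
      is an equality.\<close>
    have "(\<Sum>i=m..n. lk (ind_exp T + ind_exp ({1..n} - T)) i) = n + 1 - m" if "m \<ge> 1" for m
      using sums[OF T that, of "ind_exp T"] ind_sum[OF T, of m] by simp
    moreover have "Poly_Mapping.keys (ind_exp T) \<subseteq> {1..n}"
      using T finite_subset[OF T] by (auto simp: in_keys_iff lookup_ind_exp split: if_splits)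
    ultimately show ?thesis using T keys by (auto simp: b sp_exps_def)
  qed
  note basis = triangular_family_basis[where V = "P n j" and b = b and
      I = "{T. T \<subseteq> {1..n} \<and> card T = j}" and l = "\<lambda>S p. scoeff p (ind_exp S)" and
      w = "\<lambda>S. \<Sum>i=1..n. i * lk (ind_exp S) i" for j]
  have 1: "span (b ` {T. T \<subseteq> {1..n} \<and> card T = j}) = P n j" for j
    by (rule basis) (use subspace_P linear_scoeff b_in diag tri P_squarefree_determined in auto)
  have "dim (P n j) = card {T. T \<subseteq> {1..n} \<and> card T = j}" for j
    by (rule basis) (use subspace_P linear_scoeff b_in diag tri P_squarefree_determined in auto)
  then have 2: "dim (P n j) = n choose j" for j
    using n_subsets[of "{1..n}" j] by simp
  have 3: "b {1..n} = sp_poly n"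
    by (rule scoeff_eqI) (simp add: b scoeff_sp_poly ind_exp_def)
  show ?thesis using that b_span 1 2 3 by blast
qed

subsection \<open>The volume of the Stanley--Pitman polytope\<close>

lemma eval_sp_poly_nonneg:
  assumes "\<And>i. i \<in> {1..n} \<Longrightarrow> t i \<ge> 0"
  shows "eval t (sp_poly n) \<ge> 0"
proof -
  have "lk (sp_poly n) m \<ge> 0" for m
  proof -
    have "fact_exp m * lk (sp_poly n) m \<ge> 0"
      using scoeff_sp_poly[of n m] by (simp add: scoeff_def)
    then show ?thesis using fact_exp_pos[of m] by (simp add: zero_le_mult_iff)
  qed
  then show ?thesis
    using sp_poly_in_polys[of n] assms unfolding eval_def polys_def
    by (intro sum_nonneg mult_nonneg_nonneg prod_nonneg zero_le_power) blast+
qed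

text \<open>The tail bound at \<open>n\<close> puts \<open>t\<^sub>n\<close> into every monomial.
  This fixes the constant of integration in the volume computation.\<close>

lemma eval_sp_poly_last_zero:
  assumes "n \<ge> 1" "t n = 0"
  shows "eval t (sp_poly n) = 0"
proof -
  have "(\<Prod>i\<in>Poly_Mapping.keys m. t i ^ lk m i) = 0" if "m \<in> Poly_Mapping.keys (sp_poly n)" for m
  proof -
    have "m \<in> sp_exps n" using that by (simp add: in_keys_iff_scoeff scoeff_sp_poly)
    then have "n + 1 \<le> n + (\<Sum>i=n..n. lk m i)" using assms(1) unfolding sp_exps_def by (metis (lifting) atLeastAtMost_iff mem_Collect_eq order_refl)
    then show ?thesis using assms(2) by (intro prod_zero bexI[of _ n]) (auto simp: in_keys_iff zero_power)
  qed
  then show ?thesis unfolding eval_def by (intro sum.neutral) simp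
qed

text \<open>For \<open>n = 0\<close> the index 0 names a variable absent from the polynomial, so the
  plain derivative agrees with \<open>D 0\<close>.\<close>

lemma partial_deriv_sp_poly_Suc:
  "partial_deriv (Suc n) (sp_poly (Suc n)) - partial_deriv n (sp_poly (Suc n)) = sp_poly n"
proof -
  have "partial_deriv n (sp_poly (Suc n)) = D n (sp_poly (Suc n))"
  proof (cases "n = 0")
    case True
    have "scoeff (partial_deriv 0 (sp_poly (Suc n))) k = 0" for k
      by (simp add: scoeff_partial_deriv scoeff_sp_poly sp_exps_def keys_add_unit)
    then show ?thesis using True by (intro scoeff_eqI) (simp add: D_def scoeff_simps)
  qed (simp add: D_def)
  then show ?thesis using sp_poly_recurrence[of "Suc n"] by simp
qed

text \<open>Once the last coordinate is \<open>y\<close>, the slack \<open>t (Suc n) - y\<close> is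
  available to all earlier tail constraints, so it is added to \<open>t n\<close>.\<close>

lemma Q_Suc_fiber:
  assumes "x \<in> {1..n} \<rightarrow>\<^sub>E UNIV"
  shows "x(Suc n := y) \<in> Q (Suc n) t \<longleftrightarrow>
    y \<in> {0..t (Suc n)} \<and> x \<in> Q n (t(n := t n + t (Suc n) - y))"
proof -
  let ?t = "t(n := t n + t (Suc n) - y)" and ?x = "x(Suc n := y)"
  have sums: "(\<Sum>i=j..Suc n. ?x i) \<le> (\<Sum>i=j..Suc n. t i) \<longleftrightarrow> (\<Sum>i=j..n. x i) \<le> (\<Sum>i=j..n. ?t i)"
    if "j \<in> {1..n}" for j
  proof -
    obtain m where m: "n = Suc m" using \<open>j \<in> {1..n}\<close> by (cases n) auto
    have "(\<Sum>i=j..n. ?x i) = (\<Sum>i=j..n. x i)" "(\<Sum>i=j..m. ?t i) = (\<Sum>i=j..m. t i)"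
      by (auto intro!: sum.cong simp: m)
    moreover have "(\<Sum>i=j..Suc n. ?x i) = (\<Sum>i=j..n. ?x i) + y" "(\<Sum>i=j..Suc n. t i) = (\<Sum>i=j..n. t i) + t (Suc n)"
      "(\<Sum>i=j..n. ?t i) = (\<Sum>i=j..m. ?t i) + ?t n" "(\<Sum>i=j..n. t i) = (\<Sum>i=j..m. t i) + t n"
      using that m by simp_all
    moreover have "?t n = t n + t (Suc n) - y" by simp
    ultimately show ?thesis by linarith
  qed
  have Icc: "{1..Suc n} = insert (Suc n) {1..n}" by auto
  have "?x \<in> {1..Suc n} \<rightarrow>\<^sub>E {0..} \<longleftrightarrow> y \<ge> 0 \<and> x \<in> {1..n} \<rightarrow>\<^sub>E {0..}"
    using assms by (auto simp: PiE_iff extensional_def Icc)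
  moreover have "(\<Sum>i=Suc n..Suc n. ?x i) \<le> (\<Sum>i=Suc n..Suc n. t i) \<longleftrightarrow> y \<le> t (Suc n)" by simp
  ultimately show ?thesis using sums unfolding Q_def Icc by auto
qed

lemma sets_Q: "Q n t \<in> sets (\<Pi>\<^sub>M i\<in>{1..n}. (lborel :: real measure))"
proof -
  have "Q n t = {r \<in> space (\<Pi>\<^sub>M i\<in>{1..n}. (lborel :: real measure)).
      (\<forall>i\<in>{1..n}. 0 \<le> r i) \<and> (\<forall>j\<in>{1..n}. (\<Sum>i\<in>{j..n}. r i) \<le> (\<Sum>i=j..n. t i))}"
    by (auto simp: Q_def space_PiM PiE_iff)
  also have "\<dots> \<in> sets (\<Pi>\<^sub>M i\<in>{1..n}. (lborel :: real measure))"
    by measurable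
  finally show ?thesis .
qed

lemma emeasure_Q:
  assumes "\<And>i. i \<in> {1..n} \<Longrightarrow> t i \<ge> 0"
  shows "emeasure (\<Pi>\<^sub>M i\<in>{1..n}. lborel) (Q n t) = ennreal (eval t (sp_poly n))"
  using assms
proof (induction n arbitrary: t)
  case 0
  have "Q 0 t = {\<lambda>_. undefined}" by (auto simp: Q_def)
  moreover have "sp_exps 0 = {0}" by (auto simp: sp_exps_def)
  then have "sp_poly 0 = Const 1"
    by (simp add: sp_poly_def Const_def fact_exp_def)
  then have "eval t (sp_poly 0) = 1"
    unfolding eval_eq_subst by (simp only: real_hom.subst_Const)
  ultimately show ?case by (simp add: PiM_empty)
next
  case (Suc n)
  interpret product_sigma_finite "\<lambda>_::nat. lborel :: real measure" ..
  \<comment> \<open>The path \<open>\<psi>\<close> keeps the sum of the last two parameters at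
    \<open>c\<close>. It ends in \<open>t\<close> at \<open>u = t (Suc n)\<close> and has last
    parameter 0 at \<open>u = 0\<close>.\<close>
  define c where "c = t n + t (Suc n)"
  define \<psi> where "\<psi> = (\<lambda>u. t(n := c - u, Suc n := u))"
  let ?M = "\<lambda>n. \<Pi>\<^sub>M i\<in>{1..n::nat}. (lborel :: real measure)"
  have Icc: "{1..Suc n} = insert (Suc n) {1..n}" by auto
  have \<psi>_eval: "eval (t(n := c - u)) (sp_poly n) = eval (\<psi> u) (sp_poly n)" for u
    unfolding eval_eq_subst by (rule subst_cong[OF sp_poly_in_polys]) (auto simp: \<psi>_def)
  have nonneg: "eval (\<psi> u) (sp_poly n) \<ge> 0" if "u \<in> {0..t (Suc n)}" for u
    using that Suc.prems by (intro eval_sp_poly_nonneg) (auto simp: \<psi>_def c_def add_increasing)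
  have deriv: "((\<lambda>u. eval (\<psi> u) p) has_real_derivative
      eval (\<psi> u) (partial_deriv (Suc n) p - partial_deriv n p)) (at u)" for u p
    unfolding \<psi>_def by (rule eval_has_real_derivative) simp
  have "emeasure (?M (Suc n)) (Q (Suc n) t) = (\<integral>\<^sup>+r. indicator (Q (Suc n) t) r \<partial>?M (Suc n))"
    using sets_Q by simp
  also have "\<dots> = (\<integral>\<^sup>+y. (\<integral>\<^sup>+x. indicator (Q (Suc n) t) (x(Suc n := y)) \<partial>?M n) \<partial>lborel)"
    using sets_Q[of "Suc n" t] unfolding Icc
    by (intro product_nn_integral_insert_rev) auto
  also have "\<dots> = (\<integral>\<^sup>+y. ennreal (eval (\<psi> y) (sp_poly n)) * indicator {0..t (Suc n)} y \<partial>lborel)"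
  proof (rule nn_integral_cong)
    fix y
    have "(\<integral>\<^sup>+x. indicator (Q (Suc n) t) (x(Suc n := y)) \<partial>?M n) =
        (\<integral>\<^sup>+x. indicator {0..t (Suc n)} y * indicator (Q n (t(n := c - y))) x \<partial>?M n)"
      by (intro nn_integral_cong)
        (auto simp: space_PiM Q_Suc_fiber c_def split: split_indicator)
    also have "\<dots> = indicator {0..t (Suc n)} y * emeasure (?M n) (Q n (t(n := c - y)))"
      using sets_Q by (simp add: nn_integral_cmult)
    also have "\<dots> = ennreal (eval (\<psi> y) (sp_poly n)) * indicator {0..t (Suc n)} y"
    proof (cases "y \<in> {0..t (Suc n)}")
      case True
      \<comment> \<open>The induction hypothesis applies since \<open>y \<le> t (Suc n)\<close>
        gives \<open>c - y \<ge> t n\<close>.\<close>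
      then have "emeasure (?M n) (Q n (t(n := c - y))) = ennreal (eval (t(n := c - y)) (sp_poly n))"
        using Suc.prems by (intro Suc.IH) (auto simp: c_def add_increasing)
      then show ?thesis using True by (simp add: \<psi>_eval)
    qed simp
    finally show "(\<integral>\<^sup>+x. indicator (Q (Suc n) t) (x(Suc n := y)) \<partial>?M n) =
        ennreal (eval (\<psi> y) (sp_poly n)) * indicator {0..t (Suc n)} y" .
  qed
  \<comment> \<open>By the recurrence, \<open>sp_poly (Suc n)\<close> along the path is an
    antiderivative of the slice volume.\<close>
  also have "\<dots> = ennreal (eval (\<psi> (t (Suc n))) (sp_poly (Suc n)) - eval (\<psi> 0) (sp_poly (Suc n)))"
  proof (rule nn_integral_FTC_Icc)
    have "continuous_on UNIV (\<lambda>u. eval (\<psi> u) (sp_poly n))"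
      using deriv DERIV_isCont by (intro continuous_at_imp_continuous_on) blast
    then show "(\<lambda>u. eval (\<psi> u) (sp_poly n)) \<in> borel_measurable borel"
      by (rule borel_measurable_continuous_onI)
    show "((\<lambda>u. eval (\<psi> u) (sp_poly (Suc n))) has_real_derivative eval (\<psi> u) (sp_poly n)) (at u)" for u
      using deriv[of "sp_poly (Suc n)" u] unfolding partial_deriv_sp_poly_Suc .
  qed (use nonneg Suc.prems in auto)
  also have "eval (\<psi> 0) (sp_poly (Suc n)) = 0"
    by (rule eval_sp_poly_last_zero) (auto simp: \<psi>_def)
  also have "\<psi> (t (Suc n)) = t"
    by (auto simp: \<psi>_def c_def)
  finally show ?case by simp
qed

lemma q_eq_sp_poly: "q n = sp_poly n"
  unfolding q_def
proof (rule the_equality)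
  have eval: "eval t (sp_poly n) = measure (\<Pi>\<^sub>M i\<in>{1..n}. lborel) (Q n t)"
    if "t \<in> {1..n} \<rightarrow>\<^sub>E {0..}" for t
  proof -
    have t: "t i \<ge> 0" if "i \<in> {1..n}" for i using that \<open>t \<in> _\<close> by auto
    \<comment> \<open>\<open>ennreal\<close> sends negative numbers to 0, so nonnegativity is what
      recovers the real value from the extended measure.\<close>
    have "eval t (sp_poly n) \<ge> 0" by (rule eval_sp_poly_nonneg) (rule t)
    moreover have "emeasure (\<Pi>\<^sub>M i\<in>{1..n}. lborel) (Q n t) = ennreal (eval t (sp_poly n))"
      by (rule emeasure_Q) (rule t)
    ultimately show ?thesis by (simp add: measure_def)
  qed
  then show "sp_poly n \<in> polys n \<and>
      (\<forall>t\<in>{1..n} \<rightarrow>\<^sub>E {0..}. eval t (sp_poly n) = measure (\<Pi>\<^sub>M i\<in>{1..n}. lborel) (Q n t))"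
    using sp_poly_in_polys by blast
  show "p = sp_poly n" if "p \<in> polys n \<and>
      (\<forall>t\<in>{1..n} \<rightarrow>\<^sub>E {0..}. eval t p = measure (\<Pi>\<^sub>M i\<in>{1..n}. lborel) (Q n t))" for p
    using that eval sp_poly_in_polys by (intro polys_eqI) auto
qed

theorem theorem1:
  fixes n :: nat
  assumes "n \<ge> 1"
  shows "annihilated n (q n) \<and>
    (\<forall>p \<in> polys n. homogeneous n p \<and> annihilated n p \<longrightarrow> (\<exists>c. p = c *\<^sub>R q n)) \<and>
    (\<forall>j. P n j \<subseteq> span ((\<lambda>a. translate a (q n)) ` ({1..n} \<rightarrow>\<^sub>E UNIV))) \<and>
    (\<forall>j. dim (P n j) = n choose j)"
proof -
  obtain b :: "nat set \<Rightarrow> mpoly" where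
    b: "\<And>T. b T \<in> span ((\<lambda>a. translate a (sp_poly n)) ` ({1..n} \<rightarrow>\<^sub>E UNIV))"
    and span: "\<And>j. span (b ` {T. T \<subseteq> {1..n} \<and> card T = j}) = P n j"
    and dim: "\<And>j. dim (P n j) = n choose j"
    and top: "b {1..n} = sp_poly n"
    by (fact P_basis)
  have "T = {1..n}" if "T \<subseteq> {1..n}" "card T = n" for T
    using that by (intro card_subset_eq) auto
  \<comment> \<open>In top degree the basis is indexed by a single set, which yields uniqueness up
    to a scalar.\<close>
  then have "{T. T \<subseteq> {1..n} \<and> card T = n} = {{1..n}}" by auto
  then have "P n n = span {sp_poly n}"
    using span[of n] top by simp
  then have "\<exists>c. p = c *\<^sub>R sp_poly n" if "p \<in> polys n" "homogeneous n p" "annihilated n p" for p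
    using that by (auto simp: P_def span_singleton)
  moreover have "P n j \<subseteq> span ((\<lambda>a. translate a (sp_poly n)) ` ({1..n} \<rightarrow>\<^sub>E UNIV))" for j
    unfolding span[symmetric] using b by (intro span_minimal) auto
  ultimately show ?thesis
    unfolding q_eq_sp_poly using annihilated_sp_poly dim by (intro conjI allI ballI impI) auto
qed

end
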